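(* Let $\rho$ be a state in a convex resource theory with free set $\mathcal F$. Then $\sup_{\{p_i,\mathcal N_i\},\{A_i\},\{B_i\}}\ \frac{p_{\mathrm{succ}}(\rho,\{p_i,\mathcal N_i\},\{A_i\})\,/\,p_{\mathrm{succ}}(\rho,\{p_i,\mathcal N_i\},\{B_i\})}{\max_{\sigma\in\mathcal F}\ p_{\mathrm{succ}}(\sigma,\{p_i,\mathcal N_i\},\{A_i\})\,/\,p_{\mathrm{succ}}(\sigma,\{p_i,\mathcal N_i\},\{B_i\})}=\Omega_{\mathcal F}(\rho)$, where the supremum is over all finite channel ensembles $\{p_i,\mathcal N_i\}_{i=1}^n$ (probabilities $p_i$ and quantum channels $\mathcal N_i$ acting on the space of $\rho$) and all POVMs $\{A_i\}_{i=1}^n$, $\{B_i\}_{i=1}^n$ for which the expression is well defined.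
   Context: Finite dimensions; $A\le B$ means $B-A\ge0$. $\mathcal F$ is a closed convex set of free density operators. $R_{\max}(X\|Y)=\inf\{\lambda:X\le\lambda Y\}$ ($\inf\emptyset=\infty$); $\Omega_{\mathcal F}(\rho)=\inf_{\sigma\in\mathcal F}R_{\max}(\rho\|\sigma)R_{\max}(\sigma\|\rho)$. For a state $\omega$, a channel ensemble $\{p_i,\mathcal N_i\}$ and a POVM $\{A_i\}$, $p_{\mathrm{succ}}(\omega,\{p_i,\mathcal N_i\},\{A_i\})=\sum_i p_i\,\mathrm{Tr}[\mathcal N_i(\omega)A_i]$. *)

theory Defs
  imports "Jordan_Normal_Form.Matrix" "HOL-Library.Extended_Real"
begin

definition mtrace :: "complex mat \<Rightarrow> complex" where
  "mtrace A = (\<Sum>i<dim_row A. A $$ (i, i))"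

definition psd :: "complex mat \<Rightarrow> bool" where
  "psd A \<longleftrightarrow> dim_row A = dim_col A \<and>
     (\<forall>v :: nat \<Rightarrow> complex.
        let q = (\<Sum>i<dim_row A. \<Sum>j<dim_row A. cnj (v i) * A $$ (i, j) * v j)
        in Im q = 0 \<and> 0 \<le> Re q)"

definition loewner_le :: "complex mat \<Rightarrow> complex mat \<Rightarrow> bool" where
  "loewner_le A B \<longleftrightarrow> dim_row A = dim_row B \<and> dim_col A = dim_col B \<and> psd (B - A)"

definition density :: "nat \<Rightarrow> complex mat \<Rightarrow> bool" where
  "density d \<rho> \<longleftrightarrow> \<rho> \<in> carrier_mat d d \<and> psd \<rho> \<and> mtrace \<rho> = 1"

(* R_max(X||Y) = inf {lambda. X \<le> lambda Y}, with inf of the empty set = \<infinity> *)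
definition Rmax :: "complex mat \<Rightarrow> complex mat \<Rightarrow> ereal" where
  "Rmax X Y = Inf (ereal ` {l::real. loewner_le X (complex_of_real l \<cdot>\<^sub>m Y)})"

definition Omega :: "complex mat set \<Rightarrow> complex mat \<Rightarrow> ereal" where
  "Omega F \<rho> = (INF \<sigma>\<in>F. Rmax \<rho> \<sigma> * Rmax \<sigma> \<rho>)"

(* F is a closed convex set of density operators on a d-dimensional space.
   Closedness is w.r.t. the (unique) finite-dimensional topology, i.e. entrywise limits. *)
definition free_set :: "nat \<Rightarrow> complex mat set \<Rightarrow> bool" where
  "free_set d F \<longleftrightarrow>
     F \<subseteq> {\<rho>. density d \<rho>} \<and>
     (\<forall>\<sigma>\<in>F. \<forall>\<tau>\<in>F. \<forall>t::real. 0 \<le> t \<and> t \<le> 1 \<longrightarrow>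
        complex_of_real t \<cdot>\<^sub>m \<sigma> + complex_of_real (1 - t) \<cdot>\<^sub>m \<tau> \<in> F) \<and>
     (\<forall>s L. (\<forall>k::nat. s k \<in> F) \<and> L \<in> carrier_mat d d \<and>
        (\<forall>i<d. \<forall>j<d. (\<lambda>k. s k $$ (i, j)) \<longlonglongrightarrow> L $$ (i, j)) \<longrightarrow> L \<in> F)"

(* (id_k \<otimes> N) applied to a (k*d)x(k*d) block matrix X, for N mapping d x d to m x m:
   the (a,b) block (d x d) of X is sent to N of it. *)
definition ext_map :: "nat \<Rightarrow> nat \<Rightarrow> nat \<Rightarrow> (complex mat \<Rightarrow> complex mat) \<Rightarrow> complex mat \<Rightarrow> complex mat" where
  "ext_map k d m N X = mat (k * m) (k * m) (\<lambda>(i, j).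
      N (mat d d (\<lambda>(r, s). X $$ ((i div m) * d + r, (j div m) * d + s))) $$ (i mod m, j mod m))"

definition channel :: "nat \<Rightarrow> nat \<Rightarrow> (complex mat \<Rightarrow> complex mat) \<Rightarrow> bool" where
  "channel d m N \<longleftrightarrow>
     (\<forall>A\<in>carrier_mat d d. N A \<in> carrier_mat m m) \<and>
     (\<forall>A\<in>carrier_mat d d. \<forall>B\<in>carrier_mat d d. N (A + B) = N A + N B) \<and>
     (\<forall>A\<in>carrier_mat d d. \<forall>c. N (c \<cdot>\<^sub>m A) = c \<cdot>\<^sub>m N A) \<and>
     (\<forall>A\<in>carrier_mat d d. mtrace (N A) = mtrace A) \<and>
     (\<forall>k X. X \<in> carrier_mat (k * d) (k * d) \<and> psd X \<longrightarrow> psd (ext_map k d m N X))"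

definition channel_ensemble :: "nat \<Rightarrow> nat \<Rightarrow> nat \<Rightarrow> (nat \<Rightarrow> real) \<Rightarrow> (nat \<Rightarrow> complex mat \<Rightarrow> complex mat) \<Rightarrow> bool" where
  "channel_ensemble d m n p N \<longleftrightarrow>
     (\<forall>i<n. 0 \<le> p i \<and> channel d m (N i)) \<and> (\<Sum>i<n. p i) = 1"

definition povm :: "nat \<Rightarrow> nat \<Rightarrow> (nat \<Rightarrow> complex mat) \<Rightarrow> bool" where
  "povm m n A \<longleftrightarrow>
     (\<forall>i<n. A i \<in> carrier_mat m m \<and> psd (A i)) \<and>
     mat m m (\<lambda>(a, b). \<Sum>i<n. A i $$ (a, b)) = 1\<^sub>m m"

definition psucc :: "complex mat \<Rightarrow> nat \<Rightarrow> (nat \<Rightarrow> real) \<Rightarrow> (nat \<Rightarrow> complex mat \<Rightarrow> complex mat)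
    \<Rightarrow> (nat \<Rightarrow> complex mat) \<Rightarrow> real" where
  "psucc \<omega> n p N A = (\<Sum>i<n. p i * Re (mtrace (N i \<omega> * A i)))"

end

theory Submission
  imports "HOL-Analysis.Topology_Euclidean_Space" Defs
begin

text \<open>
  If \<open>\<rho> \<le> \<lambda>\<sigma>\<close> and \<open>\<sigma> \<le> \<mu>\<rho>\<close>, then success probabilities, being positive linear functionals of the
  state, change by at most the factors \<open>\<lambda>\<close> and \<open>\<mu>\<close>; hence no task has advantage above \<open>\<lambda>\<mu>\<close>.

  Conversely, \<open>c < \<Omega>(\<rho>)\<close> says that no \<open>S\<close> in the cone over the free set satisfies
  \<open>\<rho> \<le> S \<le> c\<rho>\<close>, i.e. that \<open>(\<rho>, c\<rho>)\<close> lies outside the closed convex cone of all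
  \<open>(S - P, S + Q)\<close> with \<open>P, Q \<ge> 0\<close>. A separating functional has the form \<open>(A, -B)\<close> with
  \<open>A, B \<ge> 0\<close>, \<open>tr A\<sigma> \<le> tr B\<sigma>\<close> for free \<open>\<sigma>\<close>, and \<open>tr A\<rho> > c tr B\<rho>\<close>. After adding a small multiple
  of the identity and rescaling, \<open>A\<close> and \<open>B\<close> are effects, and the task with two identity channels
  of probabilities \<open>1\<close> and \<open>0\<close> and the POVMs \<open>{A, 1 - A}\<close> and \<open>{B, 1 - B}\<close> has advantage above \<open>c\<close>.
\<close>

section \<open>Compactness and separation in finitely many coordinates\<close>

text \<open>Bolzano-Weierstrass, one coordinate at a time: thinning the subsequence for a new
  coordinate keeps the limits already found.\<close>

lemma finite_pointwise_convergent_subseq: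
  fixes x :: "nat \<Rightarrow> 'i \<Rightarrow> 'a::heine_borel"
  assumes "finite I" "\<And>i. i \<in> I \<Longrightarrow> bounded (range (\<lambda>n. x n i))"
  shows "\<exists>r l. strict_mono (r :: nat \<Rightarrow> nat) \<and> (\<forall>i\<in>I. (\<lambda>n. x (r n) i) \<longlonglongrightarrow> l i)"
  using assms
proof (induction I rule: finite_induct)
  case empty
  show ?case using strict_mono_id by auto
next
  case (insert k I)
  then obtain r l where r: "strict_mono (r :: nat \<Rightarrow> nat)"
    and l: "\<And>i. i \<in> I \<Longrightarrow> (\<lambda>n. x (r n) i) \<longlonglongrightarrow> l i" by auto
  have "bounded (range (\<lambda>n. x (r n) k))"
    by (rule bounded_subset[OF insert.prems[of k]]) auto
  then obtain m s where s: "strict_mono s" and m: "((\<lambda>n. x (r n) k) \<circ> s) \<longlonglongrightarrow> m"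
    using bounded_imp_convergent_subsequence by blast
  have "\<forall>i\<in>insert k I. (\<lambda>n. x ((r \<circ> s) n) i) \<longlonglongrightarrow> (l(k := m)) i"
    using m insert.hyps LIMSEQ_subseq_LIMSEQ[OF l s] by (auto simp: o_def)
  moreover have "strict_mono (r \<circ> s)" by (rule strict_mono_o[OF r s])
  ultimately show ?case by blast
qed

text \<open>The dimension is a term, not a type, so the library's hyperplane theorems do not apply;
  the separating functional is obtained by projecting the point onto the cone.\<close>

lemma closed_convex_cone_separation:
  fixes D :: "('i \<Rightarrow> 'a::euclidean_space) set"
  assumes I: "finite I" and "D \<noteq> {}"
    and add: "\<And>x y. x \<in> D \<Longrightarrow> y \<in> D \<Longrightarrow> (\<lambda>i. x i + y i) \<in> D"
    and scale: "\<And>x t. x \<in> D \<Longrightarrow> 0 \<le> t \<Longrightarrow> (\<lambda>i. t *\<^sub>R x i) \<in> D"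
    and closed: "\<And>s L. (\<And>n::nat. s n \<in> D) \<Longrightarrow> (\<And>i. i \<in> I \<Longrightarrow> (\<lambda>n. s n i) \<longlonglongrightarrow> L i) \<Longrightarrow> L \<in> D"
    and z: "z \<notin> D"
  shows "\<exists>x\<in>D. (\<forall>y\<in>D. (\<Sum>i\<in>I. inner (z i - x i) (y i)) \<le> 0) \<and>
    0 < (\<Sum>i\<in>I. inner (z i - x i) (z i))"
proof -
  define g where "g x = (\<Sum>i\<in>I. (norm (z i - x i))\<^sup>2)" for x
  have g0: "0 \<le> g x" for x unfolding g_def by (intro sum_nonneg) auto
  define m where "m = Inf (g ` D)"
  have bdd: "bdd_below (g ` D)" using g0 by (intro bdd_belowI[of _ 0]) auto
  have m_le: "m \<le> g x" if "x \<in> D" for x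
    unfolding m_def by (intro cInf_lower bdd) (use that in auto)
  have "\<exists>x\<in>D. g x < m + 1 / real (Suc n)" for n
  proof -
    have "Inf (g ` D) < m + 1 / real (Suc n)" unfolding m_def by simp
    from cInf_lessD[OF _ this] \<open>D \<noteq> {}\<close> show ?thesis by auto
  qed
  then obtain s where sD: "\<And>n. s n \<in> D" and sg: "\<And>n. g (s n) < m + 1 / real (Suc n)" by metis
  \<comment> \<open>Along a minimising sequence for the squared distance \<open>g\<close>, every
    coordinate stays within \<open>sqrt (m + 1)\<close> of \<open>z\<close>. A subsequence therefore
    converges, and its limit \<open>l\<close> is a nearest point of the cone.\<close>
  have "bounded (range (\<lambda>n. s n i))" if "i \<in> I" for i
  proof (rule boundedI)
    fix u assume "u \<in> range (\<lambda>n. s n i)"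
    then obtain n where u: "u = s n i" by auto
    have "(norm (z i - s n i))\<^sup>2 \<le> g (s n)"
      unfolding g_def by (rule member_le_sum) (use that I in auto)
    also have "\<dots> \<le> m + 1" 
    proof -
      have "1 / real (Suc n) \<le> 1" by simp
      with sg[of n] show ?thesis by linarith
    qed
    finally have "norm (z i - s n i) \<le> sqrt (m + 1)" by (rule real_le_rsqrt)
    then show "norm u \<le> norm (z i) + sqrt (m + 1)"
      using norm_triangle_ineq4[of "z i" "z i - s n i"] u by simp
  qed
  then obtain r l where r: "strict_mono (r :: nat \<Rightarrow> nat)"
    and l: "\<And>i. i \<in> I \<Longrightarrow> (\<lambda>n. s (r n) i) \<longlonglongrightarrow> l i"
    using finite_pointwise_convergent_subseq[OF I] by blast
  have lD: "l \<in> D" by (rule closed[OF _ l]) (use sD in auto)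
  have "(\<lambda>n. g (s (r n))) \<longlonglongrightarrow> g l"
    unfolding g_def by (intro tendsto_intros l)
  moreover have "(\<lambda>n. m + 1 / real (Suc (r n))) \<longlonglongrightarrow> m + 0"
    by (intro tendsto_intros LIMSEQ_subseq_LIMSEQ[OF _ r, of "\<lambda>n. 1 / real (Suc n)", unfolded o_def]
        LIMSEQ_Suc[OF lim_1_over_n])
  ultimately have "g l \<le> m + 0"
    by (rule LIMSEQ_le) (use sg less_imp_le in blast)
  then have min: "g l \<le> g y" if "y \<in> D" for y using m_le[OF that] by simp
  define ip where "ip y = (\<Sum>i\<in>I. inner (z i - l i) (y i))" for y
  have expand: "g (\<lambda>i. l i + t *\<^sub>R y i) = g l - 2 * t * ip y + t\<^sup>2 * (\<Sum>i\<in>I. (norm (y i))\<^sup>2)" for y t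
    unfolding g_def ip_def sum_distrib_left sum_subtractf[symmetric] sum.distrib[symmetric]
    unfolding power2_norm_eq_inner
    by (rule sum.cong) (auto simp: inner_simps algebra_simps power2_eq_square inner_commute)
  \<comment> \<open>First-order optimality: if moving by \<open>t\<close> never decreases the
    squared distance, the linear coefficient has the right sign. The choice
    \<open>t = b / (b + c)\<close> gives \<open>t * c \<le> b\<close>, against
    \<open>2 * b \<le> t * c\<close>.\<close>
  have quad: "b \<le> 0" if "\<And>t. 0 < t \<Longrightarrow> t \<le> 1 \<Longrightarrow> 0 \<le> - 2 * t * b + t\<^sup>2 * c" "0 \<le> c" for b c :: real
  proof (rule ccontr)
    assume b: "\<not> b \<le> 0"
    define t where "t = b / (b + c)"
    have t: "0 < t" "t \<le> 1" using b that(2) by (auto simp: t_def)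
    have "0 \<le> t * (- 2 * b + t * c)" using that(1)[OF t] by (simp add: algebra_simps power2_eq_square)
    then have "2 * b \<le> t * c" using t by (simp add: zero_le_mult_iff)
    also have "\<dots> \<le> b" using b that(2) by (simp add: t_def field_simps)
    finally show False using b by simp
  qed
  have sq: "0 \<le> (\<Sum>i\<in>I. (norm (y i))\<^sup>2)" for y :: "'i \<Rightarrow> 'a" by (intro sum_nonneg) auto
  \<comment> \<open>A cone contains \<open>l + t y\<close> for all \<open>t \<ge> 0\<close>, so
    every \<open>y\<close> in it is an admissible direction at \<open>l\<close>.\<close>
  have neg: "ip y \<le> 0" if "y \<in> D" for y
  proof (rule quad[OF _ sq[of y]])
    fix t :: real assume "0 < t"
    then have "(\<lambda>i. l i + t *\<^sub>R y i) \<in> D" using add[OF lD scale[OF that]] by simp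
    from min[OF this] show "0 \<le> - 2 * t * ip y + t\<^sup>2 * (\<Sum>i\<in>I. (norm (y i))\<^sup>2)"
      by (simp add: expand)
  qed
  \<comment> \<open>Shrinking \<open>l\<close> towards the origin stays in the cone up to
    \<open>t = 1\<close>, which is why \<open>quad\<close> only asks about
    \<open>t \<le> 1\<close>.\<close>
  have "ip (\<lambda>i. - l i) \<le> 0"
  proof (rule quad[OF _ sq[of "\<lambda>i. - l i"]])
    fix t :: real assume "0 < t" "t \<le> 1"
    then have "(\<lambda>i. (1 - t) *\<^sub>R l i) \<in> D" using scale[OF lD, of "1 - t"] by simp
    then have "(\<lambda>i. l i + t *\<^sub>R (- l i)) \<in> D" by (simp add: algebra_simps)
    from min[OF this] show "0 \<le> - 2 * t * ip (\<lambda>i. - l i) + t\<^sup>2 * (\<Sum>i\<in>I. (norm (- l i))\<^sup>2)"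
      unfolding expand by simp
  qed
  then have ipl: "0 \<le> ip l" by (simp add: ip_def sum_negf)
  \<comment> \<open>Distance zero gives agreement on \<open>I\<close> only; \<open>closed\<close>,
    applied to the constant sequence \<open>l\<close>, ignores the other coordinates and would put
    \<open>z\<close> itself into \<open>D\<close>.\<close>
  have "g l \<noteq> 0"
  proof
    assume "g l = 0"
    then have "\<forall>i\<in>I. l i = z i" unfolding g_def by (subst (asm) sum_nonneg_eq_0_iff) (use I in auto)
    then have "z \<in> D" using closed[of "\<lambda>_. l" z] lD by simp
    with z show False by simp
  qed
  moreover have "ip z = g l + ip l"
    unfolding g_def ip_def sum.distrib[symmetric]
    by (rule sum.cong) (auto simp: power2_norm_eq_inner inner_simps)
  ultimately have "0 < ip z" using g0[of l] ipl by simp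
  with lD neg show ?thesis unfolding ip_def by blast
qed

subsection \<open>Positive semidefinite matrices\<close>

text \<open>Forms are attached to entry functions rather than matrices, so that sums, multiples and
  limits carry no dimension conditions; \<open>psd_iff_pos\<close> translates back.\<close>

definition qform :: "nat \<Rightarrow> (nat \<Rightarrow> nat \<Rightarrow> complex) \<Rightarrow> (nat \<Rightarrow> complex) \<Rightarrow> complex" where
  "qform n f v = (\<Sum>i<n. \<Sum>j<n. cnj (v i) * f i j * v j)"

definition pos :: "nat \<Rightarrow> (nat \<Rightarrow> nat \<Rightarrow> complex) \<Rightarrow> bool" where
  "pos n f \<longleftrightarrow> (\<forall>v. Im (qform n f v) = 0 \<and> 0 \<le> Re (qform n f v))"

lemma psd_iff_pos: "A \<in> carrier_mat n n \<Longrightarrow> psd A \<longleftrightarrow> pos n (\<lambda>i j. A $$ (i, j))"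
  by (auto simp: psd_def pos_def qform_def Let_def)

lemma qform_cong: "(\<And>i j. i < n \<Longrightarrow> j < n \<Longrightarrow> f i j = g i j) \<Longrightarrow> qform n f v = qform n g v"
  unfolding qform_def by (intro sum.cong refl) auto

lemma pos_cong: "(\<And>i j. i < n \<Longrightarrow> j < n \<Longrightarrow> f i j = g i j) \<Longrightarrow> pos n f = pos n g"
  unfolding pos_def using qform_cong[of n f g] by simp

lemma qform_add: "qform n (\<lambda>i j. f i j + g i j) v = qform n f v + qform n g v"
  by (simp add: qform_def algebra_simps sum.distrib)

lemma qform_diff: "qform n (\<lambda>i j. f i j - g i j) v = qform n f v - qform n g v"
  by (simp add: qform_def algebra_simps sum_subtractf)

lemma qform_scale: "qform n (\<lambda>i j. c * f i j) v = c * qform n f v"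
  by (simp add: qform_def sum_distrib_left mult_ac)

lemma pos_add: "pos n f \<Longrightarrow> pos n g \<Longrightarrow> pos n (\<lambda>i j. f i j + g i j)"
  by (simp add: pos_def qform_add)

lemma pos_scale: "pos n f \<Longrightarrow> 0 \<le> t \<Longrightarrow> pos n (\<lambda>i j. complex_of_real t * f i j)"
  by (simp add: pos_def qform_scale)

lemma pos_zero: "pos n (\<lambda>i j. 0)"
  by (simp add: pos_def qform_def)

lemma qform_one: "qform n (\<lambda>i j. if i = j then 1 else 0) v = complex_of_real (\<Sum>i<n. (cmod (v i))\<^sup>2)"
proof -
  have "qform n (\<lambda>i j. if i = j then 1 else 0) v = (\<Sum>i<n. \<Sum>j<n. if i = j then cnj (v i) * v j else 0)"
    unfolding qform_def by (intro sum.cong refl) auto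
  also have "\<dots> = (\<Sum>i<n. complex_of_real ((cmod (v i))\<^sup>2))"
    by (intro sum.cong refl) (simp add: complex_norm_square mult.commute del: of_real_power)
  finally show ?thesis by simp
qed

lemma pos_one: "pos n (\<lambda>i j. if i = j then 1 else 0)"
  by (simp add: pos_def qform_one sum_nonneg)

text \<open>The form at \<open>v\<close> is the squared modulus of the inner product of
  \<open>u\<close> with \<open>v\<close>. These matrices later serve as test elements for
  positivity.\<close>

lemma pos_rank_one: "pos n (\<lambda>i j. u i * cnj (u j))"
proof -
  have "qform n (\<lambda>i j. u i * cnj (u j)) v = cnj w * w" if "w = (\<Sum>j<n. cnj (u j) * v j)" for v w
    by (simp add: qform_def that sum_product mult_ac)
  then have "qform n (\<lambda>i j. u i * cnj (u j)) v = complex_of_real ((cmod (\<Sum>j<n. cnj (u j) * v j))\<^sup>2)" for v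
    unfolding complex_norm_square by (simp add: mult.commute)
  then show ?thesis by (simp add: pos_def)
qed

lemma pos_LIMSEQ:
  assumes "\<And>k. pos n (f k)" "\<And>i j. i < n \<Longrightarrow> j < n \<Longrightarrow> (\<lambda>k::nat. f k i j) \<longlonglongrightarrow> g i j"
  shows "pos n g"
  unfolding pos_def
proof (intro allI conjI)
  fix v
  have q: "(\<lambda>k. qform n (f k) v) \<longlonglongrightarrow> qform n g v"
    unfolding qform_def by (intro tendsto_intros assms(2)) auto
  have "(\<lambda>k. 0) \<longlonglongrightarrow> Im (qform n g v)"
    using tendsto_Im[OF q] assms(1) by (simp add: pos_def)
  then show "Im (qform n g v) = 0" using LIMSEQ_unique tendsto_const by blast
  show "0 \<le> Re (qform n g v)"
    by (rule LIMSEQ_le_const[OF tendsto_Re[OF q]]) (use assms(1) in \<open>auto simp: pos_def\<close>)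
qed

text \<open>Probes entries with vectors supported on two basis elements. Writing the vector as a sum
  keeps the formula valid for \<open>i = j\<close>.\<close>

lemma qform_two:
  assumes "i < n" "j < n"
  shows "qform n f (\<lambda>k. (if k = i then a else 0) + (if k = j then b else 0)) =
    cnj a * f i i * a + cnj a * f i j * b + cnj b * f j i * a + cnj b * f j j * b"
proof -
  have *: "(if P then x else 0) * y = (if P then x * y else (0::complex))"
    "y * (if P then x else 0) = (if P then y * x else (0::complex))"
    "cnj (if P then x else 0) = (if P then cnj x else 0)" for P x y by auto
  have "qform n f (\<lambda>k. (if k = i then a else 0) + (if k = j then b else 0)) =
    (\<Sum>k<n. (if k = i then cnj a * (f k i * a + f k j * b) else 0) + (if k = j then cnj b * (f k i * a + f k j * b) else 0))"
    unfolding qform_def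
    by (intro sum.cong refl) (use assms in \<open>simp add: distrib_left distrib_right * sum.distrib mult.assoc\<close>)
  also have "\<dots> = cnj a * f i i * a + cnj a * f i j * b + cnj b * f j i * a + cnj b * f j j * b"
    using assms by (simp add: sum.distrib algebra_simps)
  finally show ?thesis .
qed

lemma pos_diag:
  assumes "pos n f" "i < n"
  shows "Im (f i i) = 0" "0 \<le> Re (f i i)"
  using assms(1)[unfolded pos_def, rule_format, of "\<lambda>k. (if k = i then 1 else 0) + (if k = i then 0 else 0)"]
    qform_two[OF assms(2,2), of f 1 0] by auto

text \<open>Polarisation: reality of the form at \<open>e_i + e_j\<close> makes the imaginary parts
  of the two entries cancel, and at \<open>e_i + \<i> e_j\<close> it makes the real parts
  agree.\<close>

lemma pos_hermitian:
  assumes "pos n f" "i < n" "j < n"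
  shows "f j i = cnj (f i j)"
proof -
  note q = assms(1)[unfolded pos_def, rule_format, THEN conjunct1]
  have "Im (f i j) + Im (f j i) = 0"
    using q[of "\<lambda>k. (if k = i then 1 else 0) + (if k = j then 1 else 0)"]
    unfolding qform_two[OF assms(2,3)] using pos_diag[OF assms(1)] assms by simp
  moreover have "Re (f i j) - Re (f j i) = 0"
    using q[of "\<lambda>k. (if k = i then 1 else 0) + (if k = j then \<i> else 0)"]
    unfolding qform_two[OF assms(2,3)] using pos_diag[OF assms(1)] assms by simp
  ultimately show ?thesis by (simp add: complex_eq_iff)
qed

text \<open>Nonnegativity at \<open>e_i \<plusminus> e_j\<close> controls the real part and at
  \<open>e_i \<plusminus> \<i> e_j\<close> the imaginary part. Hence a zero diagonal forces all
  entries to vanish, and bounded diagonals bound all entries.\<close>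

lemma pos_entry_bound:
  assumes "pos n f" "i < n" "j < n"
  shows "cmod (f i j) \<le> Re (f i i) + Re (f j j)"
proof -
  note q = assms(1)[unfolded pos_def, rule_format, THEN conjunct2]
  have "2 * \<bar>Re (f i j)\<bar> \<le> Re (f i i) + Re (f j j)"
    using q[of "\<lambda>k. (if k = i then 1 else 0) + (if k = j then 1 else 0)"]
      q[of "\<lambda>k. (if k = i then 1 else 0) + (if k = j then -1 else 0)"]
    unfolding qform_two[OF assms(2,3)] using pos_hermitian[OF assms] by simp
  moreover have "2 * \<bar>Im (f i j)\<bar> \<le> Re (f i i) + Re (f j j)"
    using q[of "\<lambda>k. (if k = i then 1 else 0) + (if k = j then \<i> else 0)"]
      q[of "\<lambda>k. (if k = i then 1 else 0) + (if k = j then -\<i> else 0)"]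
    unfolding qform_two[OF assms(2,3)] using pos_hermitian[OF assms] by simp
  ultimately show ?thesis using cmod_le[of "f i j"] by linarith
qed

text \<open>Completing the square in the \<open>k\<close>-th coordinate: a value of the Schur
  complement's form is a value of the form of \<open>f\<close> at a shifted vector, so positivity is
  inherited.\<close>

lemma qform_complete_square:
  assumes f: "pos n f" and k: "k < n" and fk: "f k k \<noteq> 0"
  shows "qform n (\<lambda>i j. f i j - f i k * cnj (f j k) / f k k) v =
    qform n f (\<lambda>i. v i - (if i = k then (\<Sum>j<n. f k j * v j) / f k k else 0))"
proof -
  define s where "s = (\<Sum>j<n. f k j * v j)"
  define c where "c = s / f k k"
  have herm: "f j k = cnj (f k j)" if "j < n" for j using pos_hermitian[OF f k that] .
  have fkk: "cnj (f k k) = f k k" using herm[OF k] by simp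
  have cs: "cnj s = (\<Sum>i<n. cnj (v i) * f i k)"
    by (simp add: s_def herm mult.commute)
  have *: "(if P then x else 0) * y = (if P then x * y else (0::complex))"
    "y * (if P then x else 0) = (if P then y * x else (0::complex))"
    "cnj (if P then x else 0) = (if P then cnj x else 0)" for P x y by auto
  have "qform n f (\<lambda>i. v i - (if i = k then c else 0)) =
     (\<Sum>i<n. (\<Sum>j<n. cnj (v i) * f i j * v j) - cnj (v i) * f i k * c
       - (if i = k then cnj c * (s - f k k * c) else 0))"
    unfolding qform_def
    by (intro sum.cong refl, use k in \<open>simp add: right_diff_distrib left_diff_distrib * sum_subtractf mult.assoc sum_distrib_left s_def\<close>)
  also have "\<dots> = qform n f v - cnj s * c - cnj c * (s - f k k * c)"
    using k by (simp add: sum_subtractf qform_def cs sum_distrib_right)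
  \<comment> \<open>The shift \<open>c\<close> is the one for which \<open>s - f k k * c\<close>
    vanishes.\<close>
  also have "\<dots> = qform n f v - cnj s * s / f k k"
    using fk by (simp add: c_def)
  also have "cnj s * s / f k k = qform n (\<lambda>i j. f i k * cnj (f j k) / f k k) v"
    unfolding cs unfolding qform_def s_def sum_product sum_divide_distrib
    by (intro sum.cong refl) (simp add: herm)
  finally show ?thesis unfolding qform_diff c_def s_def by simp
qed

text \<open>Passing to the Schur complement at \<open>k\<close> splits off a rank-one part and clears the
  \<open>k\<close>-th diagonal entry of \<open>f\<close>, so the induction is on the number of non-zero diagonal entries.\<close>

lemma pos_trace_mult_nonneg:
  assumes "pos n f" "pos n g"
  shows "0 \<le> Re (\<Sum>i<n. \<Sum>j<n. f i j * g j i)"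
  using assms(1)
proof (induction "card {i. i < n \<and> f i i \<noteq> 0}" arbitrary: f rule: less_induct)
  case less
  show ?case
  proof (cases "\<forall>i<n. f i i = 0")
    case True
    then have "f i j = 0" if "i < n" "j < n" for i j
      using pos_entry_bound[OF less.prems that] that by simp
    then show ?thesis by simp
  next
    case False
    then obtain k where k: "k < n" "f k k \<noteq> 0" by auto
    define h where "h i j = f i j - f i k * cnj (f j k) / f k k" for i j
    have h: "pos n h"
      unfolding pos_def h_def qform_complete_square[OF less.prems k]
      using less.prems by (auto simp: pos_def)
    define w where "w = Re (f k k)"
    have w: "f k k = complex_of_real w" "0 < w"
      using pos_diag[OF less.prems k(1)] k(2) by (auto simp: w_def complex_eq_iff)
    have hk: "h k k = 0" using k w by (simp add: h_def)
    \<comment> \<open>The term subtracted on the diagonal is a squared modulus over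
      \<open>w > 0\<close>. A zero diagonal entry of \<open>f\<close> therefore stays zero in
      \<open>h\<close>, squeezed between this bound and positivity.\<close>
    have le: "Re (h i i) \<le> Re (f i i)" for i
      unfolding h_def w using w(2) by (simp add: complex_mult_cnj del: of_real_add of_real_power flip: of_real_divide)
    have "{i. i < n \<and> h i i \<noteq> 0} \<subset> {i. i < n \<and> f i i \<noteq> 0}"
    proof
      show "{i. i < n \<and> h i i \<noteq> 0} \<subseteq> {i. i < n \<and> f i i \<noteq> 0}"
      proof clarify
        fix i assume "i < n" "h i i \<noteq> 0" "f i i = 0"
        then show False using le[of i] pos_diag[OF h, of i] by (auto simp: complex_eq_iff)
      qed
    qed (use k hk in auto)
    then have "card {i. i < n \<and> h i i \<noteq> 0} < card {i. i < n \<and> f i i \<noteq> 0}"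
      by (intro psubset_card_mono) auto
    from less.hyps[OF this h] have 1: "0 \<le> Re (\<Sum>i<n. \<Sum>j<n. h i j * g j i)" .
    \<comment> \<open>Paired with \<open>g\<close>, the rank-one part becomes the form of
      \<open>g\<close> at the \<open>k\<close>-th column of \<open>f\<close>, divided by
      \<open>w\<close>.\<close>
    have "(\<Sum>i<n. \<Sum>j<n. f i j * g j i) = (\<Sum>i<n. \<Sum>j<n. h i j * g j i) + qform n g (\<lambda>i. f i k) / w"
      unfolding qform_def sum.swap[of "\<lambda>i j. cnj (f i k) * g i j * f j k"]
        sum_divide_distrib sum.distrib[symmetric]
      by (intro sum.cong refl) (use w(2) in \<open>simp add: h_def w(1) field_simps\<close>)
    moreover have "0 \<le> Re (qform n g (\<lambda>i. f i k) / w)"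
      using assms(2) w(2) by (auto simp: pos_def)
    ultimately show ?thesis using 1 by simp
  qed
qed


text \<open>Each product of moduli of two coordinates of \<open>v\<close> is at most the squared
  norm of \<open>v\<close>, so the sum of the entry moduli is a crude bound on the form. It fixes
  how far a witness is scaled down to become an effect.\<close>

lemma pos_dominated:
  assumes f: "pos n f" and K: "(\<Sum>i<n. \<Sum>j<n. cmod (f i j)) \<le> K"
  shows "pos n (\<lambda>i j. complex_of_real K * (if i = j then 1 else 0) - f i j)"
  unfolding pos_def
proof (intro allI conjI)
  fix v :: "nat \<Rightarrow> complex"
  define w where "w = (\<Sum>i<n. (cmod (v i))\<^sup>2)"
  have w0: "0 \<le> w" unfolding w_def by (intro sum_nonneg) auto
  have q: "qform n (\<lambda>i j. complex_of_real K * (if i = j then 1 else 0) - f i j) v = complex_of_real (K * w) - qform n f v"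
    unfolding qform_diff qform_scale qform_one w_def by simp
  show "Im (qform n (\<lambda>i j. complex_of_real K * (if i = j then 1 else 0) - f i j) v) = 0"
    using f unfolding q by (simp add: pos_def)
  have vw: "cmod (v i) * cmod (v j) \<le> w" if "i < n" "j < n" for i j
  proof -
    have i: "(cmod (v k))\<^sup>2 \<le> w" if "k < n" for k
      unfolding w_def by (rule member_le_sum) (use that in auto)
    have "2 * (cmod (v i) * cmod (v j)) \<le> (cmod (v i))\<^sup>2 + (cmod (v j))\<^sup>2"
      using sum_squares_bound[of "cmod (v i)" "cmod (v j)"] by simp
    with i[OF that(1)] i[OF that(2)] show ?thesis by linarith
  qed
  have "Re (qform n f v) \<le> cmod (qform n f v)" by (rule complex_Re_le_cmod)
  also have "\<dots> \<le> (\<Sum>i<n. \<Sum>j<n. cmod (f i j) * w)"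
    unfolding qform_def
  proof (intro order.trans[OF norm_sum] sum_mono)
    fix i j assume "i \<in> {..<n}" "j \<in> {..<n}"
    then show "cmod (cnj (v i) * f i j * v j) \<le> cmod (f i j) * w"
      using mult_left_mono[OF vw[of i j], of "cmod (f i j)"] by (simp add: norm_mult mult_ac)
  qed
  also have "\<dots> = (\<Sum>i<n. \<Sum>j<n. cmod (f i j)) * w" by (simp add: sum_distrib_right)
  also have "\<dots> \<le> K * w" using K w0 by (rule mult_right_mono)
  finally show "0 \<le> Re (qform n (\<lambda>i j. complex_of_real K * (if i = j then 1 else 0) - f i j) v)"
    unfolding q by simp
qed

text \<open>The Hilbert--Schmidt pairing \<open>Re (tr (X f))\<close>.\<close>

definition hs :: "nat \<Rightarrow> (nat \<Rightarrow> nat \<Rightarrow> complex) \<Rightarrow> complex mat \<Rightarrow> real" where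
  "hs n f X = Re (\<Sum>i<n. \<Sum>j<n. X $$ (i, j) * f j i)"

lemma mtrace_mult:
  "X \<in> carrier_mat n n \<Longrightarrow> A \<in> carrier_mat n n \<Longrightarrow> Re (mtrace (X * A)) = hs n (\<lambda>i j. A $$ (i, j)) X"
  by (auto simp: mtrace_def hs_def scalar_prod_def atLeast0LessThan)

lemma hs_cong: "(\<And>i j. i < n \<Longrightarrow> j < n \<Longrightarrow> f i j = g i j) \<Longrightarrow> hs n f X = hs n g X"
  unfolding hs_def by (intro arg_cong[where f = Re] sum.cong refl) auto

lemma hs_nonneg: "X \<in> carrier_mat n n \<Longrightarrow> psd X \<Longrightarrow> pos n f \<Longrightarrow> 0 \<le> hs n f X"
  unfolding hs_def using pos_trace_mult_nonneg[of n "\<lambda>i j. X $$ (i, j)" f] by (simp add: psd_iff_pos)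

lemma hs_add: "hs n (\<lambda>i j. f i j + g i j) X = hs n f X + hs n g X"
  by (simp add: hs_def algebra_simps sum.distrib)

lemma hs_scale: "hs n (\<lambda>i j. complex_of_real c * f i j) X = c * hs n f X"
proof -
  have "(\<Sum>i<n. \<Sum>j<n. X $$ (i, j) * (complex_of_real c * f j i)) =
    complex_of_real c * (\<Sum>i<n. \<Sum>j<n. X $$ (i, j) * f j i)"
    by (simp add: sum_distrib_left mult_ac)
  then show ?thesis by (simp add: hs_def)
qed

lemma hs_one: "density n X \<Longrightarrow> hs n (\<lambda>i j. if i = j then 1 else 0) X = 1"
proof -
  assume X: "density n X"
  have "(\<Sum>i<n. \<Sum>j<n. X $$ (i, j) * (if j = i then 1 else 0)) = (\<Sum>i<n. X $$ (i, i))"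
    by (intro sum.cong refl) (simp add: if_distrib cong: if_cong)
  also have "\<dots> = 1" using X by (auto simp: density_def mtrace_def)
  finally show ?thesis by (simp add: hs_def)
qed

lemma hs_tendsto:
  assumes "\<And>i j. i < n \<Longrightarrow> j < n \<Longrightarrow> (\<lambda>k. s k $$ (i, j)) \<longlonglongrightarrow> L $$ (i, j)"
  shows "(\<lambda>k::nat. hs n f (s k)) \<longlonglongrightarrow> hs n f L"
  unfolding hs_def by (intro tendsto_intros assms) auto

text \<open>Hermiticity of \<open>X\<close> turns the transposed index order of the trace into a
  conjugate, giving the real Euclidean inner product in which the separating functional is
  found.\<close>

lemma hs_eq_inner:
  assumes "X \<in> carrier_mat n n" "psd X"
  shows "hs n f X = (\<Sum>(i, j)\<in>{..<n} \<times> {..<n}. inner (f i j) (X $$ (i, j)))"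
proof -
  have X: "pos n (\<lambda>i j. X $$ (i, j))" using assms by (simp add: psd_iff_pos)
  have entry: "Re (X $$ (j, i) * f i j) = inner (f i j) (X $$ (i, j))" if "i < n" "j < n" for i j
    unfolding pos_hermitian[OF X that] by (simp add: inner_complex_def algebra_simps)
  have "hs n f X = (\<Sum>i<n. \<Sum>j<n. Re (X $$ (j, i) * f i j))"
    unfolding hs_def by (subst sum.swap) simp
  also have "\<dots> = (\<Sum>i<n. \<Sum>j<n. inner (f i j) (X $$ (i, j)))"
    by (intro sum.cong refl entry) auto
  finally show ?thesis by (simp add: sum.cartesian_product)
qed

subsection \<open>The upper bound\<close>

text \<open>Complete positivity with a one-dimensional ancilla, where \<open>ext_map\<close> reduces
  to the channel itself.\<close>

lemma channel_psd:
  assumes N: "channel d m N" and X: "X \<in> carrier_mat d d" "psd X"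
  shows "N X \<in> carrier_mat m m" "psd (N X)"
proof -
  show NX: "N X \<in> carrier_mat m m" using N X by (auto simp: channel_def)
  have "mat d d (\<lambda>(r, s). X $$ (r, s)) = X" using X by (intro eq_matI) auto
  then have "ext_map 1 d m N X = N X"
    using NX by (intro eq_matI) (auto simp: ext_map_def)
  moreover have "psd (ext_map 1 d m N X)"
    using N X unfolding channel_def by (metis mult_1)
  ultimately show "psd (N X)" by simp
qed

lemma psucc_nonneg:
  assumes "channel_ensemble d m n p N" "povm m n A" "X \<in> carrier_mat d d" "psd X"
  shows "0 \<le> psucc X n p N A"
  unfolding psucc_def
proof (intro sum_nonneg mult_nonneg_nonneg)
  fix i assume "i \<in> {..<n}"
  then have i: "channel d m (N i)" "A i \<in> carrier_mat m m" "psd (A i)" "0 \<le> p i"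
    using assms by (auto simp: channel_ensemble_def povm_def)
  note NX = channel_psd[OF i(1) assms(3,4)]
  show "0 \<le> Re (mtrace (N i X * A i))"
    using hs_nonneg[OF NX] i by (simp add: mtrace_mult[OF NX(1)] psd_iff_pos)
  show "0 \<le> p i" by fact
qed

text \<open>By linearity the difference of the two sides is the value of \<open>psucc\<close> at the
  positive semidefinite gap \<open>Z\<close>.\<close>

lemma psucc_loewner:
  assumes E: "channel_ensemble d m n p N" and A: "povm m n A"
    and XY: "X \<in> carrier_mat d d" "Y \<in> carrier_mat d d"
    and le: "loewner_le X (complex_of_real l \<cdot>\<^sub>m Y)"
  shows "psucc X n p N A \<le> l * psucc Y n p N A"
proof -
  define Z where "Z = complex_of_real l \<cdot>\<^sub>m Y - X"
  have Z: "Z \<in> carrier_mat d d" "psd Z" using XY le by (auto simp: Z_def loewner_le_def)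
  \<comment> \<open>The channel axioms speak of sums and multiples, so the difference is recast as a
    sum.\<close>
  have sum: "complex_of_real l \<cdot>\<^sub>m Y = X + Z" unfolding Z_def using XY by (intro eq_matI) auto
  have key: "Re (mtrace (N i Z * A i)) = l * Re (mtrace (N i Y * A i)) - Re (mtrace (N i X * A i))" if "i < n" for i
  proof -
    have i: "channel d m (N i)" "A i \<in> carrier_mat m m"
      using that E A by (auto simp: channel_ensemble_def povm_def)
    have c: "N i X \<in> carrier_mat m m" "N i Y \<in> carrier_mat m m" "N i Z \<in> carrier_mat m m"
      using i(1) XY Z by (auto simp: channel_def)
    have "complex_of_real l \<cdot>\<^sub>m N i Y = N i X + N i Z"
      using i(1) XY Z sum unfolding channel_def by metis
    then have e: "N i Z $$ (a, b) = complex_of_real l * N i Y $$ (a, b) - N i X $$ (a, b)" if "a < m" "b < m" for a b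
      using c that by (metis add_diff_cancel_left' carrier_matD index_add_mat(1) index_smult_mat(1))
    have "(\<Sum>a<m. \<Sum>b<m. N i Z $$ (a, b) * A i $$ (b, a)) =
       complex_of_real l * (\<Sum>a<m. \<Sum>b<m. N i Y $$ (a, b) * A i $$ (b, a)) - (\<Sum>a<m. \<Sum>b<m. N i X $$ (a, b) * A i $$ (b, a))"
      unfolding sum_distrib_left sum_subtractf[symmetric]
      by (intro sum.cong refl) (simp add: e algebra_simps)
    then show ?thesis
      using c i by (simp add: mtrace_mult hs_def)
  qed
  have "psucc Z n p N A = l * psucc Y n p N A - psucc X n p N A"
    unfolding psucc_def sum_distrib_left sum_subtractf[symmetric]
    by (intro sum.cong refl) (simp add: key algebra_simps)
  with psucc_nonneg[OF E A Z] show ?thesis by simp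
qed

section \<open>Bounds on \<open>Rmax\<close> and on products of two such values\<close>

text \<open>The trace of the positive semidefinite gap is \<open>l - 1\<close>.\<close>

lemma loewner_density_ge_1:
  assumes "density d X" "density d Y" "loewner_le X (complex_of_real l \<cdot>\<^sub>m Y)"
  shows "1 \<le> l"
proof -
  have c: "X \<in> carrier_mat d d" "Y \<in> carrier_mat d d" using assms by (auto simp: density_def)
  have "pos d (\<lambda>i j. (complex_of_real l \<cdot>\<^sub>m Y - X) $$ (i, j))"
    using assms c by (subst psd_iff_pos[symmetric]) (auto simp: loewner_le_def)
  then have "0 \<le> (\<Sum>i<d. Re ((complex_of_real l \<cdot>\<^sub>m Y - X) $$ (i, i)))"
    by (intro sum_nonneg) (auto intro: pos_diag)
  also have "\<dots> = l * Re (mtrace Y) - Re (mtrace X)"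
    using c by (simp add: mtrace_def sum_subtractf sum_distrib_left)
  finally show ?thesis using assms by (simp add: density_def)
qed

lemma Rmax_le: "loewner_le X (complex_of_real l \<cdot>\<^sub>m Y) \<Longrightarrow> Rmax X Y \<le> ereal l"
  unfolding Rmax_def by (intro Inf_lower) auto

lemma le_Rmax: "(\<And>l. loewner_le X (complex_of_real l \<cdot>\<^sub>m Y) \<Longrightarrow> c \<le> l) \<Longrightarrow> ereal c \<le> Rmax X Y"
  unfolding Rmax_def by (intro Inf_greatest) auto

lemma Rmax_ge_1: "density d X \<Longrightarrow> density d Y \<Longrightarrow> 1 \<le> Rmax X Y"
  using le_Rmax[of X Y 1] loewner_density_ge_1 by (simp add: one_ereal_def)

text \<open>The two infima are taken one after the other: for fixed feasible \<open>l\<close> the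
  quotient \<open>c / l\<close> bounds the second infimum \<open>b\<close> from below, and then
  \<open>c / b\<close> bounds the first. All divisors are at least 1.\<close>

lemma le_Rmax_mult:
  assumes X: "density d X" and Y: "density d Y"
    and le: "\<And>l m. loewner_le X (complex_of_real l \<cdot>\<^sub>m Y) \<Longrightarrow> loewner_le Y (complex_of_real m \<cdot>\<^sub>m X) \<Longrightarrow> c \<le> l * m"
  shows "ereal c \<le> Rmax X Y * Rmax Y X"
proof -
  have ge: "1 \<le> Rmax X Y" "1 \<le> Rmax Y X" using Rmax_ge_1 X Y by auto
  show ?thesis
  proof (cases "Rmax X Y = \<infinity> \<or> Rmax Y X = \<infinity>")
    \<comment> \<open>Both factors are at least 1, so an infinite one makes the product
      infinite.\<close>
    case True
    then show ?thesis using ge by (cases "Rmax X Y"; cases "Rmax Y X") (auto simp: one_ereal_def)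
  next
    case False
    then obtain a b where ab: "Rmax X Y = ereal a" "Rmax Y X = ereal b"
      using ge by (cases "Rmax X Y"; cases "Rmax Y X") auto
    then have b: "1 \<le> b" using ge by (simp add: one_ereal_def)
    have "c / b \<le> l" if l: "loewner_le X (complex_of_real l \<cdot>\<^sub>m Y)" for l
    proof -
      have l1: "1 \<le> l" using loewner_density_ge_1[OF X Y l] .
      have "ereal (c / l) \<le> Rmax Y X"
        by (rule le_Rmax) (use le[OF l] l1 in \<open>simp add: field_simps\<close>)
      then show ?thesis using l1 b unfolding ab by (simp add: field_simps)
    qed
    then have "ereal (c / b) \<le> Rmax X Y" by (rule le_Rmax)
    then show ?thesis using b unfolding ab by (simp add: field_simps)
  qed
qed

subsection \<open>The dual witness\<close>

text \<open>Unit trace bounds each diagonal entry by 1, and two of them bound any entry. Only a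
  uniform bound matters, for compactness.\<close>

lemma density_entry_bound:
  assumes "density d \<sigma>" "i < d" "j < d"
  shows "cmod (\<sigma> $$ (i, j)) \<le> 2"
proof -
  have p: "pos d (\<lambda>i j. \<sigma> $$ (i, j))" using assms by (auto simp: density_def psd_iff_pos)
  have dim: "dim_row \<sigma> = d" using assms by (auto simp: density_def)
  have "Re (\<sigma> $$ (k, k)) \<le> 1" if "k < d" for k
  proof -
    have "Re (\<sigma> $$ (k, k)) \<le> (\<Sum>k<d. Re (\<sigma> $$ (k, k)))"
      by (rule member_le_sum) (use that pos_diag[OF p] in auto)
    also have "\<dots> = Re (mtrace \<sigma>)" using dim by (simp add: mtrace_def)
    finally show ?thesis using assms by (simp add: density_def)
  qed
  from this[OF assms(2)] this[OF assms(3)] pos_entry_bound[OF p assms(2,3)] show ?thesis by linarith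
qed

lemma free_set_density: "free_set d F \<Longrightarrow> \<sigma> \<in> F \<Longrightarrow> density d \<sigma>"
  by (auto simp: free_set_def)

text \<open>Sequential compactness of the free set: uniformly bounded entries together with
  closedness under entrywise limits.\<close>

lemma free_set_convergent_subseq:
  assumes F: "free_set d F" and s: "\<And>k::nat. s k \<in> F"
  obtains r L where "strict_mono (r :: nat \<Rightarrow> nat)" "L \<in> F"
    "\<And>i j. i < d \<Longrightarrow> j < d \<Longrightarrow> (\<lambda>k. s (r k) $$ (i, j)) \<longlonglongrightarrow> L $$ (i, j)"
proof -
  have "bounded (range (\<lambda>n. s n $$ q))" if "q \<in> {..<d} \<times> {..<d}" for q
    using density_entry_bound[OF free_set_density[OF F s]] that by (intro boundedI[of _ 2]) auto
  from finite_pointwise_convergent_subseq[of "{..<d} \<times> {..<d}" "\<lambda>n q. s n $$ q", OF _ this]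
  obtain r l where r: "strict_mono (r :: nat \<Rightarrow> nat)"
    and l: "\<forall>q\<in>{..<d} \<times> {..<d}. (\<lambda>n. s (r n) $$ q) \<longlonglongrightarrow> l q" by auto
  define L where "L = mat d d l"
  have lim: "(\<lambda>k. s (r k) $$ (i, j)) \<longlonglongrightarrow> L $$ (i, j)" if "i < d" "j < d" for i j
    using l that by (auto simp: L_def)
  moreover have "L \<in> F"
  proof -
    have "(\<forall>k. s (r k) \<in> F) \<and> L \<in> carrier_mat d d \<and>
      (\<forall>i<d. \<forall>j<d. (\<lambda>k. s (r k) $$ (i, j)) \<longlonglongrightarrow> L $$ (i, j))"
      using s lim by (auto simp: L_def)
    then show ?thesis
      using F[unfolded free_set_def, THEN conjunct2, THEN conjunct2, rule_format, of "\<lambda>k. s (r k)" L] by blast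
  qed
  ultimately show thesis using that r by blast
qed

text \<open>Convexity in cone form: the mixture with weight \<open>s / (s + t)\<close> is free, and
  scaling it by \<open>s + t\<close> recovers the sum. With both weights zero any free state
  serves.\<close>

lemma free_set_cone_add:
  assumes F: "free_set d F" and "\<sigma> \<in> F" "\<tau> \<in> F" "0 \<le> s" "0 \<le> t"
  obtains \<omega> where "\<omega> \<in> F" "\<And>i j. i < d \<Longrightarrow> j < d \<Longrightarrow>
    complex_of_real (s + t) * \<omega> $$ (i, j) = complex_of_real s * \<sigma> $$ (i, j) + complex_of_real t * \<tau> $$ (i, j)"
proof (cases "s + t = 0")
  case True
  then have "s = 0" "t = 0" using assms by auto
  then show thesis using that[OF assms(2)] by simp
next
  case False
  define u where "u = s / (s + t)"
  have u: "0 \<le> u" "u \<le> 1" "(s + t) * u = s" "(s + t) * (1 - u) = t"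
    using False assms by (auto simp: u_def field_simps)
  have c: "\<sigma> \<in> carrier_mat d d" "\<tau> \<in> carrier_mat d d"
    using free_set_density[OF F] assms by (auto simp: density_def)
  have "complex_of_real u \<cdot>\<^sub>m \<sigma> + complex_of_real (1 - u) \<cdot>\<^sub>m \<tau> \<in> F"
    using F assms u unfolding free_set_def by blast
  then show thesis
  proof (rule that)
    fix i j assume "i < d" "j < d"
    then have "complex_of_real (s + t) * (complex_of_real u \<cdot>\<^sub>m \<sigma> + complex_of_real (1 - u) \<cdot>\<^sub>m \<tau>) $$ (i, j)
      = complex_of_real ((s + t) * u) * \<sigma> $$ (i, j) + complex_of_real ((s + t) * (1 - u)) * \<tau> $$ (i, j)"
      using c by (simp add: algebra_simps)
    then show "complex_of_real (s + t) * (complex_of_real u \<cdot>\<^sub>m \<sigma> + complex_of_real (1 - u) \<cdot>\<^sub>m \<tau>) $$ (i, j)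
      = complex_of_real s * \<sigma> $$ (i, j) + complex_of_real t * \<tau> $$ (i, j)"
      unfolding u .
  qed
qed

text \<open>The entries of the pairs \<open>(S - P, S + Q)\<close> with \<open>S\<close> in the cone over \<open>F\<close> and \<open>P, Q \<ge> 0\<close>.\<close>

definition sandwich_cone :: "nat \<Rightarrow> complex mat set \<Rightarrow> (nat \<times> nat \<Rightarrow> complex \<times> complex) set" where
  "sandwich_cone d F = {x. \<exists>t\<ge>0. \<exists>\<sigma>\<in>F.
     pos d (\<lambda>i j. complex_of_real t * \<sigma> $$ (i, j) - fst (x (i, j))) \<and>
     pos d (\<lambda>i j. snd (x (i, j)) - complex_of_real t * \<sigma> $$ (i, j))}"

lemma sandwich_coneI:
  assumes "0 \<le> t" "\<sigma> \<in> F"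
    "pos d (\<lambda>i j. complex_of_real t * \<sigma> $$ (i, j) - fst (x (i, j)))"
    "pos d (\<lambda>i j. snd (x (i, j)) - complex_of_real t * \<sigma> $$ (i, j))"
  shows "x \<in> sandwich_cone d F"
  using assms unfolding sandwich_cone_def by blast

lemma sandwich_cone_add:
  assumes F: "free_set d F" and x: "x \<in> sandwich_cone d F" and y: "y \<in> sandwich_cone d F"
  shows "(\<lambda>q. x q + y q) \<in> sandwich_cone d F"
proof -
  obtain s \<sigma> where s: "0 \<le> s" "\<sigma> \<in> F"
    "pos d (\<lambda>i j. complex_of_real s * \<sigma> $$ (i, j) - fst (x (i, j)))"
    "pos d (\<lambda>i j. snd (x (i, j)) - complex_of_real s * \<sigma> $$ (i, j))"
    using x unfolding sandwich_cone_def by blast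
  obtain t \<tau> where t: "0 \<le> t" "\<tau> \<in> F"
    "pos d (\<lambda>i j. complex_of_real t * \<tau> $$ (i, j) - fst (y (i, j)))"
    "pos d (\<lambda>i j. snd (y (i, j)) - complex_of_real t * \<tau> $$ (i, j))"
    using y unfolding sandwich_cone_def by blast
  obtain \<omega> where \<omega>: "\<omega> \<in> F" "\<And>i j. i < d \<Longrightarrow> j < d \<Longrightarrow>
    complex_of_real (s + t) * \<omega> $$ (i, j) = complex_of_real s * \<sigma> $$ (i, j) + complex_of_real t * \<tau> $$ (i, j)"
    using free_set_cone_add[OF F s(2) t(2) s(1) t(1)] by blast
  show ?thesis
  proof (rule sandwich_coneI[of "s + t" \<omega>])
    show "pos d (\<lambda>i j. complex_of_real (s + t) * \<omega> $$ (i, j) - fst (x (i, j) + y (i, j)))"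
      using pos_add[OF s(3) t(3)] by (rule pos_cong[THEN iffD1, rotated]) (simp add: \<omega>(2) del: of_real_add)
    show "pos d (\<lambda>i j. snd (x (i, j) + y (i, j)) - complex_of_real (s + t) * \<omega> $$ (i, j))"
      using pos_add[OF s(4) t(4)] by (rule pos_cong[THEN iffD1, rotated]) (simp add: \<omega>(2) del: of_real_add)
  qed (use s t \<omega> in auto)
qed

lemma sandwich_cone_scale:
  assumes x: "x \<in> sandwich_cone d F" and c: "0 \<le> c"
  shows "(\<lambda>q. c *\<^sub>R x q) \<in> sandwich_cone d F"
proof -
  obtain s \<sigma> where s: "0 \<le> s" "\<sigma> \<in> F"
    "pos d (\<lambda>i j. complex_of_real s * \<sigma> $$ (i, j) - fst (x (i, j)))"
    "pos d (\<lambda>i j. snd (x (i, j)) - complex_of_real s * \<sigma> $$ (i, j))"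
    using x unfolding sandwich_cone_def by blast
  show ?thesis
    by (rule sandwich_coneI[of "c * s" \<sigma>])
      (use s c pos_scale[OF s(3) c] pos_scale[OF s(4) c] in
        \<open>simp_all add: scaleR_conv_of_real right_diff_distrib mult.assoc\<close>)
qed

text \<open>The danger is that the weights \<open>t n\<close> escape to infinity. Since
  \<open>S \<le> S + Q\<close> and free states have trace one, each weight is at most the trace of
  the second component, which converges. Compactness of \<open>F\<close> then supplies a limiting
  pair of weight and state.\<close>

lemma sandwich_cone_closed:
  assumes F: "free_set d F" and x: "\<And>n::nat. x n \<in> sandwich_cone d F"
    and L: "\<And>q. q \<in> {..<d} \<times> {..<d} \<Longrightarrow> (\<lambda>n. x n q) \<longlonglongrightarrow> L q"
  shows "L \<in> sandwich_cone d F"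
proof -
  define Q where "Q n t \<sigma> \<longleftrightarrow> 0 \<le> t \<and> \<sigma> \<in> F \<and>
    pos d (\<lambda>i j. complex_of_real t * \<sigma> $$ (i, j) - fst (x n (i, j))) \<and>
    pos d (\<lambda>i j. snd (x n (i, j)) - complex_of_real t * \<sigma> $$ (i, j))" for n t \<sigma>
  have "\<exists>t \<sigma>. Q n t \<sigma>" for n
    using x[of n] unfolding sandwich_cone_def Q_def by blast
  then obtain t \<sigma> where Q: "\<And>n. Q n (t n) (\<sigma> n)" by metis
  have t0: "0 \<le> t n" and \<sigma>: "\<sigma> n \<in> F"
    and p1: "pos d (\<lambda>i j. complex_of_real (t n) * \<sigma> n $$ (i, j) - fst (x n (i, j)))"
    and p2: "pos d (\<lambda>i j. snd (x n (i, j)) - complex_of_real (t n) * \<sigma> n $$ (i, j))" for n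
    using Q[of n] by (auto simp: Q_def)
  have t_le: "t n \<le> (\<Sum>i<d. Re (snd (x n (i, i))))" for n
  proof -
    have "0 \<le> (\<Sum>i<d. Re (snd (x n (i, i)) - complex_of_real (t n) * \<sigma> n $$ (i, i)))"
      using pos_diag(2)[OF p2[of n]] by (intro sum_nonneg) auto
    also have "\<dots> = (\<Sum>i<d. Re (snd (x n (i, i)))) - t n * Re (\<Sum>i<d. \<sigma> n $$ (i, i))"
      by (simp add: sum_subtractf sum_distrib_left)
    also have "(\<Sum>i<d. \<sigma> n $$ (i, i)) = 1"
      using free_set_density[OF F \<sigma>[of n]] by (auto simp: density_def mtrace_def)
    finally show ?thesis by simp
  qed
  have "(\<lambda>n. \<Sum>i<d. Re (snd (x n (i, i)))) \<longlonglongrightarrow> (\<Sum>i<d. Re (snd (L (i, i))))"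
    by (intro tendsto_intros L) auto
  then have "Bseq (\<lambda>n. \<Sum>i<d. Re (snd (x n (i, i))))" by (intro convergent_imp_Bseq convergentI)
  then obtain K where K: "\<And>n. \<bar>\<Sum>i<d. Re (snd (x n (i, i)))\<bar> \<le> K" by (auto simp: Bseq_def)
  obtain r \<tau> where r: "strict_mono (r :: nat \<Rightarrow> nat)" and \<tau>: "\<tau> \<in> F"
    and lim: "\<And>i j. i < d \<Longrightarrow> j < d \<Longrightarrow> (\<lambda>k. \<sigma> (r k) $$ (i, j)) \<longlonglongrightarrow> \<tau> $$ (i, j)"
    using free_set_convergent_subseq[OF F, of \<sigma>] \<sigma> by blast
  have "bounded (range (\<lambda>n. t (r n)))"
  proof (rule boundedI[of _ K], clarify)
    fix n show "norm (t (r n)) \<le> K" using t0[of "r n"] t_le[of "r n"] K[of "r n"] by simp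
  qed
  \<comment> \<open>A further subsequence of the one for the states makes the weights converge as
    well; both limits are then taken along \<open>r (s k)\<close>.\<close>
  then obtain u s where s: "strict_mono (s :: nat \<Rightarrow> nat)" and u: "((\<lambda>n. t (r n)) \<circ> s) \<longlonglongrightarrow> u"
    using bounded_imp_convergent_subsequence by blast
  have u: "(\<lambda>n. t (r (s n))) \<longlonglongrightarrow> u" using u by (simp add: o_def)
  have lim: "(\<lambda>k. \<sigma> (r (s k)) $$ (i, j)) \<longlonglongrightarrow> \<tau> $$ (i, j)" if "i < d" "j < d" for i j
    using LIMSEQ_subseq_LIMSEQ[OF lim[OF that] s] by (simp add: o_def)
  have limx: "(\<lambda>k. x (r (s k)) (i, j)) \<longlonglongrightarrow> L (i, j)" if "i < d" "j < d" for i j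
    using LIMSEQ_subseq_LIMSEQ[OF L[of "(i, j)"] strict_mono_o[OF r s]] that by (simp add: o_def)
  show ?thesis
  proof (rule sandwich_coneI[of u \<tau>])
    show "0 \<le> u" by (rule LIMSEQ_le_const[OF u]) (use t0 in auto)
    show "\<tau> \<in> F" by fact
    show "pos d (\<lambda>i j. complex_of_real u * \<tau> $$ (i, j) - fst (L (i, j)))"
      by (rule pos_LIMSEQ[where f = "\<lambda>k i j. complex_of_real (t (r (s k))) * \<sigma> (r (s k)) $$ (i, j) - fst (x (r (s k)) (i, j))", OF p1])
        (intro tendsto_intros u lim limx; assumption)
    show "pos d (\<lambda>i j. snd (L (i, j)) - complex_of_real u * \<tau> $$ (i, j))"
      by (rule pos_LIMSEQ[where f = "\<lambda>k i j. snd (x (r (s k)) (i, j)) - complex_of_real (t (r (s k))) * \<sigma> (r (s k)) $$ (i, j)", OF p2])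
        (intro tendsto_intros u lim limx; assumption)
  qed
qed

section \<open>The separating functional as a pair of positive forms\<close>

text \<open>Real inner products with rank-one matrices see only the real part of the form;
  hermiticity supplies that it is real.\<close>

lemma pos_if_hermitian:
  assumes herm: "\<And>i j. i < n \<Longrightarrow> j < n \<Longrightarrow> f j i = cnj (f i j)"
    and nonneg: "\<And>v. 0 \<le> (\<Sum>(i, j)\<in>{..<n} \<times> {..<n}. inner (f i j) (v i * cnj (v j)))"
  shows "pos n f"
  unfolding pos_def
proof (intro allI conjI)
  fix v
  have "cnj (qform n f v) = (\<Sum>i<n. \<Sum>j<n. v i * cnj (f i j) * cnj (v j))"
    by (simp add: qform_def)
  also have "\<dots> = (\<Sum>i<n. \<Sum>j<n. cnj (v j) * f j i * v i)"
    by (intro sum.cong refl) (simp add: herm[symmetric] mult_ac)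
  also have "\<dots> = qform n f v" unfolding qform_def by (rule sum.swap)
  finally show "Im (qform n f v) = 0" by (simp add: complex_eq_iff)
  have "Re (qform n f v) = (\<Sum>i<n. \<Sum>j<n. inner (f i j) (v i * cnj (v j)))"
    unfolding qform_def Re_sum
    by (intro sum.cong refl) (simp add: inner_complex_def algebra_simps)
  then show "0 \<le> Re (qform n f v)" using nonneg[of v] by (simp add: sum.cartesian_product)
qed

text \<open>The displacement from the nearest cone point to \<open>(\<rho>, c \<rho>)\<close>
  provides \<open>f\<close> and, up to sign, \<open>g\<close>. Their properties are read off by
  testing the functional on particular cone elements and on the separated point.\<close>

lemma dual_witness:
  assumes F: "free_set d F" "F \<noteq> {}" and \<rho>: "density d \<rho>"
    and infeasible: "\<not> (\<exists>t\<ge>0. \<exists>\<sigma>\<in>F.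
      pos d (\<lambda>i j. complex_of_real t * \<sigma> $$ (i, j) - \<rho> $$ (i, j)) \<and>
      pos d (\<lambda>i j. complex_of_real c * \<rho> $$ (i, j) - complex_of_real t * \<sigma> $$ (i, j)))"
  obtains f g where "pos d f" "pos d g" "\<And>\<sigma>. \<sigma> \<in> F \<Longrightarrow> hs d f \<sigma> \<le> hs d g \<sigma>"
    "c * hs d g \<rho> < hs d f \<rho>"
proof -
  let ?I = "{..<d} \<times> {..<d}"
  define z where "z = (\<lambda>q. (\<rho> $$ q, complex_of_real c * \<rho> $$ q))"
  obtain \<sigma>0 where \<sigma>0: "\<sigma>0 \<in> F" using F by blast
  \<comment> \<open>Three families of test elements: \<open>(-P, 0)\<close> will give
    \<open>f \<ge> 0\<close>, \<open>(0, Q)\<close> will give \<open>g \<ge> 0\<close>, and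
    \<open>(\<sigma>, \<sigma>)\<close> the inequality on free states. In the first two the weight
    is 0 and \<open>\<sigma>0\<close> is a placeholder.\<close>
  have neg_P: "(\<lambda>(i, j). (- (v i * cnj (v j)), 0)) \<in> sandwich_cone d F" for v
    by (rule sandwich_coneI[of 0 \<sigma>0]) (use \<sigma>0 pos_rank_one[of d v] pos_zero in auto)
  have pos_Q: "(\<lambda>(i, j). (0, v i * cnj (v j))) \<in> sandwich_cone d F" for v
    by (rule sandwich_coneI[of 0 \<sigma>0]) (use \<sigma>0 pos_rank_one[of d v] pos_zero in auto)
  have diag: "(\<lambda>q. (\<sigma> $$ q, \<sigma> $$ q)) \<in> sandwich_cone d F" if "\<sigma> \<in> F" for \<sigma>
    by (rule sandwich_coneI[of 1 \<sigma>]) (use that pos_zero in auto)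
  have sep_ex: "\<exists>x\<in>sandwich_cone d F.
      (\<forall>y\<in>sandwich_cone d F. (\<Sum>q\<in>?I. inner (z q - x q) (y q)) \<le> 0) \<and>
      0 < (\<Sum>q\<in>?I. inner (z q - x q) (z q))"
  proof (rule closed_convex_cone_separation)
    show "sandwich_cone d F \<noteq> {}" using diag[OF \<sigma>0] by blast
    show "z \<notin> sandwich_cone d F" using infeasible unfolding sandwich_cone_def z_def by auto
    show "L \<in> sandwich_cone d F" if "\<And>n::nat. s n \<in> sandwich_cone d F"
      "\<And>q. q \<in> ?I \<Longrightarrow> (\<lambda>n. s n q) \<longlonglongrightarrow> L q" for s L
      using that by (rule sandwich_cone_closed[OF F(1)])
  qed (simp_all add: sandwich_cone_add[OF F(1)] sandwich_cone_scale)
  obtain x where x: "x \<in> sandwich_cone d F"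
    and sep: "\<And>y. y \<in> sandwich_cone d F \<Longrightarrow> (\<Sum>q\<in>?I. inner (z q - x q) (y q)) \<le> 0"
    and z: "0 < (\<Sum>q\<in>?I. inner (z q - x q) (z q))"
    using sep_ex by blast
  define f where "f i j = \<rho> $$ (i, j) - fst (x (i, j))" for i j
  \<comment> \<open>The sign is reversed relative to \<open>f\<close>, so that the functional is the
    pairing with \<open>f\<close> minus the pairing with \<open>g\<close>.\<close>
  define g where "g i j = snd (x (i, j)) - complex_of_real c * \<rho> $$ (i, j)" for i j
  have ip: "(\<Sum>q\<in>?I. inner (z q - x q) (y q)) =
      (\<Sum>(i, j)\<in>?I. inner (f i j) (fst (y (i, j)))) - (\<Sum>(i, j)\<in>?I. inner (g i j) (snd (y (i, j))))" for y
    unfolding sum_subtractf[symmetric]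
    by (intro sum.cong refl)
      (auto simp: z_def f_def g_def inner_prod_def inner_diff_left case_prod_beta)
  have \<rho>p: "pos d (\<lambda>i j. \<rho> $$ (i, j))" using \<rho> by (auto simp: density_def psd_iff_pos)
  obtain t \<sigma> where t: "\<sigma> \<in> F"
    "pos d (\<lambda>i j. complex_of_real t * \<sigma> $$ (i, j) - fst (x (i, j)))"
    "pos d (\<lambda>i j. snd (x (i, j)) - complex_of_real t * \<sigma> $$ (i, j))"
    using x unfolding sandwich_cone_def by blast
  have \<sigma>p: "pos d (\<lambda>i j. \<sigma> $$ (i, j))"
    using free_set_density[OF F(1) t(1)] by (auto simp: density_def psd_iff_pos)
  \<comment> \<open>Real inner products cannot detect anti-Hermitian parts, so hermiticity of
    \<open>f\<close> and \<open>g\<close> is derived from membership of \<open>x\<close> in the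
    cone: its components differ from \<open>t * \<sigma>\<close> by positive matrices.\<close>
  have hf: "f j i = cnj (f i j)" if "i < d" "j < d" for i j
    using pos_hermitian[OF \<rho>p that] pos_hermitian[OF t(2) that] pos_hermitian[OF \<sigma>p that]
    by (simp add: f_def)
  have hg: "g j i = cnj (g i j)" if "i < d" "j < d" for i j
    using pos_hermitian[OF \<rho>p that] pos_hermitian[OF t(3) that] pos_hermitian[OF \<sigma>p that]
    by (simp add: g_def)
  show thesis
  proof
    show "pos d f"
    proof (rule pos_if_hermitian[OF hf])
      fix v show "0 \<le> (\<Sum>(i, j)\<in>?I. inner (f i j) (v i * cnj (v j)))"
        using sep[OF neg_P[of v]] by (simp add: ip case_prod_beta sum_negf)
    qed
    show "pos d g"
    proof (rule pos_if_hermitian[OF hg])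
      fix v show "0 \<le> (\<Sum>(i, j)\<in>?I. inner (g i j) (v i * cnj (v j)))"
        using sep[OF pos_Q[of v]] by (simp add: ip case_prod_beta)
    qed
    show "hs d f \<sigma> \<le> hs d g \<sigma>" if "\<sigma> \<in> F" for \<sigma>
      using sep[OF diag[OF that]] free_set_density[OF F(1) that]
      by (simp add: ip hs_eq_inner density_def)
    show "c * hs d g \<rho> < hs d f \<rho>"
    proof -
      have "(\<Sum>(i, j)\<in>?I. inner (g i j) (complex_of_real c * \<rho> $$ (i, j))) = c * (\<Sum>(i, j)\<in>?I. inner (g i j) (\<rho> $$ (i, j)))"
        unfolding sum_distrib_left by (intro sum.cong refl) (auto simp: scaleR_conv_of_real[symmetric])
      then show ?thesis
        using z \<rho> by (simp add: ip hs_eq_inner density_def) (simp add: z_def)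
    qed
  qed
qed

subsection \<open>The lower bound\<close>

lemma channel_id:
  assumes "0 < d"
  shows "channel d d (\<lambda>X. X)"
proof -
  have "ext_map k d d (\<lambda>X. X) X = X" if "X \<in> carrier_mat (k * d) (k * d)" for k X
    using that assms by (intro eq_matI) (auto simp: ext_map_def)
  then show ?thesis by (simp add: channel_def)
qed

text \<open>The POVM is \<open>f\<close> with its complement. All probability sits on index 0, so
  only the first outcome is ever scored.\<close>

lemma effect_psucc:
  assumes f: "pos d f" "pos d (\<lambda>i j. (if i = j then 1 else 0) - f i j)"
  obtains A where "povm d 2 A"
    "\<And>X. X \<in> carrier_mat d d \<Longrightarrow> psucc X 2 (\<lambda>i. if i = 0 then 1 else 0) (\<lambda>_ X. X) A = hs d f X"
proof
  define A where "A = (\<lambda>k::nat. mat d d (\<lambda>(i, j). if k = 0 then f i j else (if i = j then 1 else 0) - f i j))"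
  have "psd (A k)" for k
  proof -
    have "pos d (\<lambda>i j. A k $$ (i, j)) = pos d (\<lambda>i j. if k = 0 then f i j else (if i = j then 1 else 0) - f i j)"
      by (rule pos_cong) (auto simp: A_def)
    moreover have "pos d (\<lambda>i j. if k = 0 then f i j else (if i = j then 1 else 0) - f i j)"
      using f by (cases "k = 0") auto
    moreover have "A k \<in> carrier_mat d d" by (simp add: A_def)
    ultimately show ?thesis by (simp add: psd_iff_pos)
  qed
  then show "povm d 2 A"
    unfolding povm_def by (auto simp: A_def numeral_2_eq_2 intro!: eq_matI)
  show "psucc X 2 (\<lambda>i. if i = 0 then 1 else 0) (\<lambda>_ X. X) A = hs d f X" if X: "X \<in> carrier_mat d d" for X
  proof -
    have "psucc X 2 (\<lambda>i. if i = 0 then 1 else 0) (\<lambda>_ X. X) A = Re (mtrace (X * A 0))"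
      by (simp add: psucc_def numeral_2_eq_2)
    also have "\<dots> = hs d (\<lambda>i j. A 0 $$ (i, j)) X" by (rule mtrace_mult[OF X]) (simp add: A_def)
    also have "\<dots> = hs d f X" by (rule hs_cong) (simp add: A_def)
    finally show ?thesis .
  qed
qed

text \<open>A continuous ratio on a compact set: a maximising sequence has a limit in
  \<open>F\<close>, and the positive denominators make the ratio converge along it. The bound
  \<open>K\<close> makes the supremum a real number.\<close>

lemma free_set_ratio_attains_max:
  assumes F: "free_set d F" "F \<noteq> {}"
    and g: "\<And>\<sigma>. \<sigma> \<in> F \<Longrightarrow> 0 < hs d g \<sigma>" and bound: "\<And>\<sigma>. \<sigma> \<in> F \<Longrightarrow> hs d f \<sigma> / hs d g \<sigma> \<le> K"
  obtains \<sigma>\<^sub>0 where "\<sigma>\<^sub>0 \<in> F" "\<And>\<sigma>. \<sigma> \<in> F \<Longrightarrow> hs d f \<sigma> / hs d g \<sigma> \<le> hs d f \<sigma>\<^sub>0 / hs d g \<sigma>\<^sub>0"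
proof -
  define h where "h \<sigma> = hs d f \<sigma> / hs d g \<sigma>" for \<sigma>
  define M where "M = Sup (h ` F)"
  have bdd: "bdd_above (h ` F)" using bound by (auto simp: h_def intro!: bdd_aboveI)
  have le_M: "h \<sigma> \<le> M" if "\<sigma> \<in> F" for \<sigma>
    unfolding M_def by (intro cSup_upper bdd) (use that in auto)
  have "\<exists>\<sigma>\<in>F. M - 1 / real (Suc n) < h \<sigma>" for n
  proof -
    have "M - 1 / real (Suc n) < Sup (h ` F)" unfolding M_def by simp
    from less_cSupD[OF _ this] F show ?thesis by auto
  qed
  then obtain s where s: "\<And>n. s n \<in> F" "\<And>n. M - 1 / real (Suc n) < h (s n)" by metis
  obtain r L where r: "strict_mono (r :: nat \<Rightarrow> nat)" and L: "L \<in> F"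
    and lim: "\<And>i j. i < d \<Longrightarrow> j < d \<Longrightarrow> (\<lambda>k. s (r k) $$ (i, j)) \<longlonglongrightarrow> L $$ (i, j)"
    using free_set_convergent_subseq[OF F(1), of s] s by blast
  have hL: "(\<lambda>n. h (s (r n))) \<longlonglongrightarrow> h L"
    unfolding h_def using g[OF L] by (intro tendsto_intros hs_tendsto lim) auto
  have "(\<lambda>n. M - 1 / real (Suc (r n))) \<longlonglongrightarrow> M - 0"
    by (intro tendsto_intros LIMSEQ_subseq_LIMSEQ[OF _ r, of "\<lambda>n. 1 / real (Suc n)", unfolded o_def]
        LIMSEQ_Suc[OF lim_1_over_n])
  from this hL have "M - 0 \<le> h L"
    by (rule LIMSEQ_le) (use s less_imp_le in blast)
  then have "h \<sigma> \<le> h L" if "\<sigma> \<in> F" for \<sigma> using le_M[OF that] by simp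
  with that L show thesis unfolding h_def by blast
qed

text \<open>A sandwich \<open>\<rho> \<le> t \<sigma> \<le> c \<rho>\<close> makes \<open>t\<close>
  and \<open>c / t\<close> feasible for the two \<open>Rmax\<close> values, so \<open>Omega\<close>
  would be at most their product \<open>c\<close>.\<close>

lemma infeasible_below_Omega:
  assumes F: "free_set d F" and \<rho>: "density d \<rho>" and c: "ereal c < Omega F \<rho>"
  shows "\<not> (\<exists>t\<ge>0. \<exists>\<sigma>\<in>F.
      pos d (\<lambda>i j. complex_of_real t * \<sigma> $$ (i, j) - \<rho> $$ (i, j)) \<and>
      pos d (\<lambda>i j. complex_of_real c * \<rho> $$ (i, j) - complex_of_real t * \<sigma> $$ (i, j)))"
proof clarify
  fix t \<sigma>
  assume t: "0 \<le> t" and \<sigma>: "\<sigma> \<in> F"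
    and p1: "pos d (\<lambda>i j. complex_of_real t * \<sigma> $$ (i, j) - \<rho> $$ (i, j))"
    and p2: "pos d (\<lambda>i j. complex_of_real c * \<rho> $$ (i, j) - complex_of_real t * \<sigma> $$ (i, j))"
  have \<sigma>d: "density d \<sigma>" by (rule free_set_density[OF F \<sigma>])
  have ca: "\<rho> \<in> carrier_mat d d" "\<sigma> \<in> carrier_mat d d" using \<rho> \<sigma>d by (auto simp: density_def)
  have "pos d (\<lambda>i j. (complex_of_real t \<cdot>\<^sub>m \<sigma> - \<rho>) $$ (i, j))"
    using p1 by (rule pos_cong[THEN iffD1, rotated]) (use ca in auto)
  then have l1: "loewner_le \<rho> (complex_of_real t \<cdot>\<^sub>m \<sigma>)"
    using ca psd_iff_pos[OF minus_carrier_mat[OF ca(1)]] by (auto simp: loewner_le_def)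
  \<comment> \<open>This licenses the division by \<open>t\<close> below.\<close>
  then have t1: "1 \<le> t" by (rule loewner_density_ge_1[OF \<rho> \<sigma>d])
  have "pos d (\<lambda>i j. (complex_of_real (c / t) \<cdot>\<^sub>m \<rho> - \<sigma>) $$ (i, j))"
    using pos_scale[OF p2, of "1 / t"]
    by (rule pos_cong[THEN iffD1, rotated]) (use ca t1 in \<open>auto simp: field_simps\<close>)
  then have l2: "loewner_le \<sigma> (complex_of_real (c / t) \<cdot>\<^sub>m \<rho>)"
    using ca psd_iff_pos[OF minus_carrier_mat[OF ca(2)]] by (auto simp: loewner_le_def)
  have "Omega F \<rho> \<le> Rmax \<rho> \<sigma> * Rmax \<sigma> \<rho>" unfolding Omega_def by (rule INF_lower[OF \<sigma>])
  also have "\<dots> \<le> ereal t * ereal (c / t)"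
  proof (rule ereal_mult_mono)
    show "0 \<le> Rmax \<sigma> \<rho>" by (rule order.trans[OF _ Rmax_ge_1[OF \<sigma>d \<rho>]]) simp
    show "0 \<le> ereal t" using t by simp
  qed (use Rmax_le l1 l2 in auto)
  also have "\<dots> = ereal c" using t1 by simp
  finally show False using c by simp
qed

text \<open>The shifted witnesses have ratio above \<open>c\<close> at \<open>\<rho>\<close> and at
  most 1 on free states. One common factor turns both into effects and cancels in every
  ratio.\<close>

lemma discrimination_advantage_exceeds:
  assumes "free_set d F" and "F \<noteq> {}" and "density d \<rho>" and c: "ereal c < Omega F \<rho>"
  shows "\<exists>m n p N A B \<sigma>\<^sub>0. channel_ensemble d m n p N \<and> povm m n A \<and> povm m n B \<and>
    psucc \<rho> n p N B \<noteq> 0 \<and> (\<forall>\<sigma>\<in>F. psucc \<sigma> n p N B \<noteq> 0) \<and> \<sigma>\<^sub>0 \<in> F \<and>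
    (\<forall>\<sigma>\<in>F. psucc \<sigma> n p N A / psucc \<sigma> n p N B \<le> psucc \<sigma>\<^sub>0 n p N A / psucc \<sigma>\<^sub>0 n p N B) \<and>
    psucc \<sigma>\<^sub>0 n p N A / psucc \<sigma>\<^sub>0 n p N B \<noteq> 0 \<and>
    c < psucc \<rho> n p N A / psucc \<rho> n p N B / (psucc \<sigma>\<^sub>0 n p N A / psucc \<sigma>\<^sub>0 n p N B)"
proof -
  obtain f g where f: "pos d f" and g: "pos d g" and fg: "\<And>\<sigma>. \<sigma> \<in> F \<Longrightarrow> hs d f \<sigma> \<le> hs d g \<sigma>"
    and gap: "c * hs d g \<rho> < hs d f \<rho>"
    using dual_witness[OF assms(1-3) infeasible_below_Omega[OF assms(1,3) c]] by blast
  let ?ps = "\<lambda>X. psucc X 2 (\<lambda>i. if i = 0 then 1 else 0) (\<lambda>_ X. X)"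
  let ?one = "\<lambda>i j :: nat. if i = j then 1 else (0 :: complex)"
  \<comment> \<open>Adding \<open>e\<close> times the identity to both witnesses makes all denominators non-zero.\<close>
  define e where "e = (hs d f \<rho> - c * hs d g \<rho>) / (1 + \<bar>c\<bar>)"
  have e: "0 < e" using gap by (simp add: e_def)
  \<comment> \<open>By the choice of \<open>e\<close>, the gap equals
    \<open>e + \<bar>c\<bar> * e\<close>; the shift raises the left side by at most
    \<open>\<bar>c\<bar> * e\<close>, so strictness survives for either sign of
    \<open>c\<close>.\<close>
  have "c * e \<le> \<bar>c\<bar> * e" using e by (intro mult_right_mono) auto
  moreover have "(1 + \<bar>c\<bar>) * e = hs d f \<rho> - c * hs d g \<rho>" by (simp add: e_def)
  ultimately have gap_e: "c * (hs d g \<rho> + e) < hs d f \<rho> + e"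
    using e unfolding distrib_left distrib_right by linarith
  define S where "S h = (\<Sum>i<d. \<Sum>j<d. cmod (h i j + complex_of_real e * ?one i j))" for h
  have S0: "0 \<le> S h" for h unfolding S_def by (intro sum_nonneg) auto
  \<comment> \<open>A single scale dominating both entry sums; the summand 1 keeps it
    positive.\<close>
  define K where "K = 1 + S f + S g"
  have K: "0 < K" using S0[of f] S0[of g] by (simp add: K_def)
  define effect where "effect h i j = complex_of_real (1 / K) * (h i j + complex_of_real e * ?one i j)" for h i j
  have hs_effect: "hs d (effect h) X = (hs d h X + e) / K" if "density d X" for h X
    unfolding effect_def hs_scale hs_add hs_one[OF that] by simp
  have effect: "\<exists>A. povm d 2 A \<and> (\<forall>X\<in>carrier_mat d d.
    ?ps X A = hs d (effect h) X)" if h: "pos d h" "S h \<le> K" for h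
  proof -
    have p: "pos d (\<lambda>i j. h i j + complex_of_real e * ?one i j)"
      using e by (intro pos_add h pos_scale pos_one) auto
    have "pos d (effect h)" unfolding effect_def using K by (intro pos_scale p) auto
    moreover have "pos d (\<lambda>i j. ?one i j - effect h i j)"
    proof -
      have "pos d (\<lambda>i j. complex_of_real (1 / K) * (complex_of_real K * ?one i j - (h i j + complex_of_real e * ?one i j)))"
        using K h(2) by (intro pos_scale pos_dominated p) (auto simp: S_def)
      then show ?thesis
        by (rule pos_cong[THEN iffD1, rotated]) (use K in \<open>auto simp: effect_def field_simps\<close>)
    qed
    ultimately obtain A where "povm d 2 A" "\<And>X. X \<in> carrier_mat d d \<Longrightarrow> ?ps X A = hs d (effect h) X"
      using effect_psucc by blast
    then show ?thesis by blast
  qed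
  have "S f \<le> K" "S g \<le> K" using S0[of f] S0[of g] by (auto simp: K_def)
  then obtain A B where A: "povm d 2 A" and effA: "\<forall>X\<in>carrier_mat d d. ?ps X A = hs d (effect f) X"
    and B: "povm d 2 B" and effB: "\<forall>X\<in>carrier_mat d d. ?ps X B = hs d (effect g) X"
    using effect[OF f] effect[OF g] by blast
  have psA: "?ps X A = (hs d f X + e) / K" and psB: "?ps X B = (hs d g X + e) / K" if "density d X" for X
    using effA effB hs_effect[OF that] that by (auto simp: density_def)
  note Fd = free_set_density[OF assms(1)]
  have f0: "0 < hs d f X + e" and g0: "0 < hs d g X + e" if "density d X" for X
    using hs_nonneg[OF _ _ f, of X] hs_nonneg[OF _ _ g, of X] that e by (auto simp: density_def)
  have ratio: "(hs d f \<sigma> + e) / (hs d g \<sigma> + e) \<le> 1" if "\<sigma> \<in> F" for \<sigma>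
    using fg[OF that] g0[OF Fd[OF that]] by simp
  obtain \<sigma>\<^sub>0 where \<sigma>\<^sub>0: "\<sigma>\<^sub>0 \<in> F" and max: "\<And>\<sigma>. \<sigma> \<in> F \<Longrightarrow>
      hs d (effect f) \<sigma> / hs d (effect g) \<sigma> \<le> hs d (effect f) \<sigma>\<^sub>0 / hs d (effect g) \<sigma>\<^sub>0"
    by (rule free_set_ratio_attains_max[OF assms(1,2), of "effect g" "effect f" 1])
      (use ratio g0 Fd K in \<open>auto simp: hs_effect\<close>)
  \<comment> \<open>In dimension 0 the trace would be 0 instead of 1.\<close>
  have d: "0 < d" using assms(3) by (cases d) (auto simp: density_def mtrace_def)
  have E: "channel_ensemble d d 2 (\<lambda>i. if i = 0 then 1 else 0) (\<lambda>_ X. X)"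
    using channel_id[OF d] by (auto simp: channel_ensemble_def numeral_2_eq_2)
  define M where "M = (hs d f \<sigma>\<^sub>0 + e) / (hs d g \<sigma>\<^sub>0 + e)"
  have M: "0 < M" "M \<le> 1" using f0 g0 Fd[OF \<sigma>\<^sub>0] ratio[OF \<sigma>\<^sub>0] by (auto simp: M_def)
  have ps_ratio: "?ps X A / ?ps X B = (hs d f X + e) / (hs d g X + e)" if "density d X" for X
    using K by (simp add: psA psB that)
  have \<rho>B: "?ps \<rho> B \<noteq> 0" using g0[OF assms(3)] K by (simp add: psB assms(3))
  have FB: "\<forall>\<sigma>\<in>F. ?ps \<sigma> B \<noteq> 0" using g0 Fd K by (force simp: psB)
  have FM: "\<forall>\<sigma>\<in>F. ?ps \<sigma> A / ?ps \<sigma> B \<le> ?ps \<sigma>\<^sub>0 A / ?ps \<sigma>\<^sub>0 B"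
    using max by (simp add: psA psB hs_effect Fd \<sigma>\<^sub>0)
  have M0: "?ps \<sigma>\<^sub>0 A / ?ps \<sigma>\<^sub>0 B \<noteq> 0"
    unfolding ps_ratio[OF Fd[OF \<sigma>\<^sub>0]] M_def[symmetric] using M(1) by simp
  define x where "x = (hs d f \<rho> + e) / (hs d g \<rho> + e)"
  have "0 < x" using f0[OF assms(3)] g0[OF assms(3)] by (simp add: x_def)
  \<comment> \<open>The free maximum \<open>M\<close> lies in \<open>(0, 1]\<close>, so dividing by
    it can only enlarge the ratio at \<open>\<rho>\<close>.\<close>
  then have "x \<le> x / M" using M by (simp add: pos_le_divide_eq mult_left_le)
  moreover have "c < x" using gap_e g0[OF assms(3)] unfolding x_def by (simp only: pos_less_divide_eq)
  ultimately have "c < ?ps \<rho> A / ?ps \<rho> B / (?ps \<sigma>\<^sub>0 A / ?ps \<sigma>\<^sub>0 B)"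
    unfolding ps_ratio[OF assms(3)] ps_ratio[OF Fd[OF \<sigma>\<^sub>0]] M_def[symmetric] x_def[symmetric] by linarith
  then show ?thesis
    by (intro exI[of _ d] exI[of _ 2] exI[of _ "\<lambda>i. if i = 0 then 1 else 0"] exI[of _ "\<lambda>_ X. X"]
        exI[of _ A] exI[of _ B] exI[of _ \<sigma>\<^sub>0] conjI E A B \<sigma>\<^sub>0 \<rho>B FB FM M0)
qed

text \<open>The maximum in the denominator is represented by a free state
  \<open>\<sigma>\<^sub>0\<close> attaining it. Well-definedness is expressed by nonzero success
  probabilities for \<open>B\<close> at \<open>\<rho>\<close> and on \<open>F\<close>, and a nonzero
  maximum.\<close>

theorem theorem10:
  fixes d :: nat and F :: "complex mat set" and \<rho> :: "complex mat"
  assumes "free_set d F" and "F \<noteq> {}" and "density d \<rho>"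
  shows "Sup {ereal ((psucc \<rho> n p N A / psucc \<rho> n p N B) /
                     (psucc \<sigma>\<^sub>0 n p N A / psucc \<sigma>\<^sub>0 n p N B))
            | m n p N A B \<sigma>\<^sub>0.
              channel_ensemble d m n p N \<and> povm m n A \<and> povm m n B \<and>
              psucc \<rho> n p N B \<noteq> 0 \<and>
              (\<forall>\<sigma>\<in>F. psucc \<sigma> n p N B \<noteq> 0) \<and>
              \<sigma>\<^sub>0 \<in> F \<and>
              (\<forall>\<sigma>\<in>F. psucc \<sigma> n p N A / psucc \<sigma> n p N B
                        \<le> psucc \<sigma>\<^sub>0 n p N A / psucc \<sigma>\<^sub>0 n p N B) \<and>
              psucc \<sigma>\<^sub>0 n p N A / psucc \<sigma>\<^sub>0 n p N B \<noteq> 0}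
         = Omega F \<rho>"
    (is "Sup ?S = _")
proof (rule antisym)
  have \<rho>: "\<rho> \<in> carrier_mat d d" "psd \<rho>" using assms(3) by (auto simp: density_def)
  have Fc: "\<sigma> \<in> carrier_mat d d" "psd \<sigma>" if "\<sigma> \<in> F" for \<sigma>
    using free_set_density[OF assms(1) that] by (auto simp: density_def)
  show "Sup ?S \<le> Omega F \<rho>"
    unfolding Omega_def
  proof (intro Sup_least INF_greatest, clarify)
    fix \<sigma> m n p N A B \<sigma>\<^sub>0
    assume \<sigma>: "\<sigma> \<in> F" and E: "channel_ensemble d m n p N" and A: "povm m n A" and B: "povm m n B"
      and \<rho>B: "psucc \<rho> n p N B \<noteq> 0" and \<sigma>B: "\<forall>\<sigma>\<in>F. psucc \<sigma> n p N B \<noteq> 0" and \<sigma>\<^sub>0: "\<sigma>\<^sub>0 \<in> F"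
      and max: "\<forall>\<sigma>\<in>F. psucc \<sigma> n p N A / psucc \<sigma> n p N B \<le> psucc \<sigma>\<^sub>0 n p N A / psucc \<sigma>\<^sub>0 n p N B"
      and nz: "psucc \<sigma>\<^sub>0 n p N A / psucc \<sigma>\<^sub>0 n p N B \<noteq> 0"
    define M where "M = psucc \<sigma>\<^sub>0 n p N A / psucc \<sigma>\<^sub>0 n p N B"
    have M: "0 < M"
      using nz psucc_nonneg[OF E A Fc[OF \<sigma>\<^sub>0]] psucc_nonneg[OF E B Fc[OF \<sigma>\<^sub>0]]
      by (simp add: M_def less_le)
    have \<rho>B: "0 < psucc \<rho> n p N B" using \<rho>B psucc_nonneg[OF E B \<rho>] by simp
    have \<sigma>B: "0 < psucc \<sigma> n p N B" using \<sigma>B \<sigma> psucc_nonneg[OF E B Fc[OF \<sigma>]] by (simp add: less_le)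
    show "ereal ((psucc \<rho> n p N A / psucc \<rho> n p N B) / (psucc \<sigma>\<^sub>0 n p N A / psucc \<sigma>\<^sub>0 n p N B))
      \<le> Rmax \<rho> \<sigma> * Rmax \<sigma> \<rho>"
      unfolding M_def[symmetric]
    proof (rule le_Rmax_mult[OF assms(3) free_set_density[OF assms(1) \<sigma>]])
      fix l k
      assume l: "loewner_le \<rho> (complex_of_real l \<cdot>\<^sub>m \<sigma>)" and k: "loewner_le \<sigma> (complex_of_real k \<cdot>\<^sub>m \<rho>)"
      have l1: "1 \<le> l" using loewner_density_ge_1[OF assms(3) free_set_density[OF assms(1) \<sigma>] l] .
      \<comment> \<open>Three exchanges: from \<open>\<rho>\<close> to \<open>\<sigma>\<close> under
        \<open>A\<close> at cost \<open>l\<close>, from \<open>A\<close> to \<open>B\<close> at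
        \<open>\<sigma>\<close> at cost \<open>M\<close>, and from \<open>\<sigma>\<close> back to
        \<open>\<rho>\<close> under \<open>B\<close> at cost \<open>k\<close>.\<close>
      have "psucc \<rho> n p N A \<le> l * psucc \<sigma> n p N A" by (rule psucc_loewner[OF E A \<rho>(1) Fc(1)[OF \<sigma>] l])
      also have "\<dots> \<le> l * (M * psucc \<sigma> n p N B)"
      proof (rule mult_left_mono)
        have "psucc \<sigma> n p N A / psucc \<sigma> n p N B \<le> M" using max \<sigma> unfolding M_def by blast
        then show "psucc \<sigma> n p N A \<le> M * psucc \<sigma> n p N B" by (simp add: pos_divide_le_eq \<sigma>B)
      qed (use l1 in simp)
      also have "\<dots> \<le> l * (M * (k * psucc \<rho> n p N B))"
        using l1 M psucc_loewner[OF E B Fc(1)[OF \<sigma>] \<rho>(1) k] by (intro mult_left_mono) auto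
      finally have "psucc \<rho> n p N A \<le> l * (M * (k * psucc \<rho> n p N B))" .
      then show "psucc \<rho> n p N A / psucc \<rho> n p N B / M \<le> l * k"
        using M \<rho>B by (simp add: field_simps)
    qed
  qed
  show "Omega F \<rho> \<le> Sup ?S"
  proof (rule leI, rule notI)
    assume "Sup ?S < Omega F \<rho>"
    from ereal_dense2[OF this] obtain c where c: "Sup ?S < ereal c" "ereal c < Omega F \<rho>" by blast
    obtain m n p N A B \<sigma>\<^sub>0 where w: "channel_ensemble d m n p N \<and> povm m n A \<and> povm m n B \<and>
    psucc \<rho> n p N B \<noteq> 0 \<and> (\<forall>\<sigma>\<in>F. psucc \<sigma> n p N B \<noteq> 0) \<and> \<sigma>\<^sub>0 \<in> F \<and>
    (\<forall>\<sigma>\<in>F. psucc \<sigma> n p N A / psucc \<sigma> n p N B \<le> psucc \<sigma>\<^sub>0 n p N A / psucc \<sigma>\<^sub>0 n p N B) \<and>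
    psucc \<sigma>\<^sub>0 n p N A / psucc \<sigma>\<^sub>0 n p N B \<noteq> 0"
      and gt: "c < psucc \<rho> n p N A / psucc \<rho> n p N B / (psucc \<sigma>\<^sub>0 n p N A / psucc \<sigma>\<^sub>0 n p N B)"
      using discrimination_advantage_exceeds[OF assms c(2)] by blast
    have "ereal c \<le> ereal (psucc \<rho> n p N A / psucc \<rho> n p N B / (psucc \<sigma>\<^sub>0 n p N A / psucc \<sigma>\<^sub>0 n p N B))" using gt by simp
    also have "\<dots> \<le> Sup ?S" using w by (intro Sup_upper) blast
    finally show False using c(1) by simp
  qed
qed

end
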